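(* Let $M$ and $N$ be commutative monoids and let $\varphi : M \to N$ be a monoid homomorphism. Then the map $$\varphi_\ast : \mathrm{Filt}\,M \to \mathrm{Filt}\,N,\qquad F \mapsto F(\varphi(F)),$$ where $F(\varphi(F))$ is the filter of $N$ generated by the image set $\varphi(F)$, is continuous. With this assignment on morphisms, $M\mapsto \mathrm{Filt}\,M$ is a covariant functor from the category of commutative monoids to the category of topological spaces.
   Context: Let $M$ be a commutative monoid, written multiplicatively with neutral element $1$; $g$ divides $f$ if $f = g\cdot a$ for some $a\in M$. A filter in $M$ is a subset $F \subseteq M$ such that (1) $1\in F$; (2) $f,g\in F$ implies $f\cdot g\in F$; (3) if $f\in F$ and $g$ divides $f$, then $g\in F$. (The whole monoid is allowed as a filter.) For a subset $S\subseteq M$, $F(S)$ denotes the smallest filter of $M$ containing $S$; it consists of all divisors of finite products of elements of $S$ (the empty product being $1$). $\mathrm{Filt}\,M$ denotes the set of all filters of $M$ with the topology having as basis the sets $D(f) = \{F \in \mathrm{Filt}\,M : f\in F\}$, $f\in M$. *)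

theory Defs
  imports "HOL-Algebra.Divisibility" "HOL-Analysis.Abstract_Topology"
begin

section \<open>Filters in commutative monoids\<close>

definition monoid_filter :: "('a, 'm) monoid_scheme \<Rightarrow> 'a set \<Rightarrow> bool" where
  "monoid_filter M F \<longleftrightarrow>
     F \<subseteq> carrier M \<and>
     \<one>\<^bsub>M\<^esub> \<in> F \<and>
     (\<forall>f\<in>F. \<forall>g\<in>F. f \<otimes>\<^bsub>M\<^esub> g \<in> F) \<and>
     (\<forall>f\<in>F. \<forall>g\<in>carrier M. g divides\<^bsub>M\<^esub> f \<longrightarrow> g \<in> F)"

definition Filt :: "('a, 'm) monoid_scheme \<Rightarrow> 'a set set" where
  "Filt M = {F. monoid_filter M F}"

text \<open>The intersection of all filters containing \<open>S\<close>; it is itself a filter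
  (\<open>monoid_filter_filter_gen\<close>) for \<open>S \<subseteq> carrier M\<close>, hence the smallest one containing \<open>S\<close>.\<close>

definition filter_gen :: "('a, 'm) monoid_scheme \<Rightarrow> 'a set \<Rightarrow> 'a set" where
  "filter_gen M S = monoid_filter M hull S"

definition basic_open :: "('a, 'm) monoid_scheme \<Rightarrow> 'a \<Rightarrow> 'a set set" where
  "basic_open M f = {F \<in> Filt M. f \<in> F}"

definition filt_top :: "('a, 'm) monoid_scheme \<Rightarrow> 'a set topology" where
  "filt_top M = topology (arbitrary union_of (\<lambda>U. \<exists>f\<in>carrier M. U = basic_open M f))"

text \<open>The library's \<^const>\<open>hom\<close> does not require preservation of the neutral element.\<close>

definition monoid_hom ::
    "('a, 'm) monoid_scheme \<Rightarrow> ('b, 'n) monoid_scheme \<Rightarrow> ('a \<Rightarrow> 'b) set" where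
  "monoid_hom M N = {\<phi> \<in> hom M N. \<phi> \<one>\<^bsub>M\<^esub> = \<one>\<^bsub>N\<^esub>}"

text \<open>Restricted to \<^term>\<open>Filt M\<close>, so that equality in HOL is equality of maps on \<^term>\<open>Filt M\<close>.\<close>

definition filt_map ::
    "('a, 'm) monoid_scheme \<Rightarrow> ('b, 'n) monoid_scheme \<Rightarrow> ('a \<Rightarrow> 'b) \<Rightarrow> 'a set \<Rightarrow> 'b set" where
  "filt_map M N \<phi> = (\<lambda>F\<in>Filt M. filter_gen N (\<phi> ` F))"

lemma monoid_filter_carrier:
  assumes "monoid M"
  shows "monoid_filter M (carrier M)"
proof -
  interpret monoid M by fact
  show ?thesis by (auto simp: monoid_filter_def)
qed

lemma monoid_filter_filter_gen:
  assumes "monoid M" and "S \<subseteq> carrier M"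
  shows "monoid_filter M (filter_gen M S)"
proof -
  have sub: "filter_gen M S \<subseteq> carrier M"
    using hull_minimal[of S "carrier M" "monoid_filter M"] assms(2) monoid_filter_carrier[OF assms(1)]
    by (simp add: filter_gen_def)
  have gen_iff:
    "x \<in> filter_gen M S \<longleftrightarrow> (\<forall>F. monoid_filter M F \<and> S \<subseteq> F \<longrightarrow> x \<in> F)" for x
    by (simp add: filter_gen_def hull_def)
  have div: "g \<in> filter_gen M S"
    if "f \<in> filter_gen M S" "g \<in> carrier M" "g divides\<^bsub>M\<^esub> f" for f g
    unfolding gen_iff
  proof (intro allI impI)
    fix F assume F: "monoid_filter M F \<and> S \<subseteq> F"
    then have "f \<in> F" using that(1) gen_iff by simp
    then show "g \<in> F" using F that(2,3) unfolding monoid_filter_def by simp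
  qed
  have one: "\<one>\<^bsub>M\<^esub> \<in> filter_gen M S"
    unfolding gen_iff by (simp add: monoid_filter_def)
  have mult: "f \<otimes>\<^bsub>M\<^esub> g \<in> filter_gen M S" if "f \<in> filter_gen M S" "g \<in> filter_gen M S" for f g
    using that unfolding gen_iff by (simp add: monoid_filter_def)
  show ?thesis
    unfolding monoid_filter_def by (intro conjI ballI impI sub one) (erule (1) mult, erule (2) div)
qed

lemma basic_open_mult:
  assumes "comm_monoid M" and "f \<in> carrier M" and "g \<in> carrier M"
  shows "basic_open M f \<inter> basic_open M g = basic_open M (f \<otimes>\<^bsub>M\<^esub> g)"
proof -
  interpret comm_monoid M by fact
  have "f divides\<^bsub>M\<^esub> (f \<otimes>\<^bsub>M\<^esub> g)" "g divides\<^bsub>M\<^esub> (f \<otimes>\<^bsub>M\<^esub> g)"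
    using assms(2,3) m_comm by (auto simp: factor_def)
  then show ?thesis
    using assms(2,3) unfolding basic_open_def Filt_def monoid_filter_def by blast
qed

lemma openin_filt_top:
  assumes "comm_monoid M"
  shows "openin (filt_top M) = arbitrary union_of (\<lambda>U. \<exists>f\<in>carrier M. U = basic_open M f)"
proof -
  interpret comm_monoid M by fact
  have "istopology (arbitrary union_of (\<lambda>U. \<exists>f\<in>carrier M. U = basic_open M f))"
  proof (rule istopology_base)
    fix S T
    assume "\<exists>f\<in>carrier M. S = basic_open M f" and "\<exists>f\<in>carrier M. T = basic_open M f"
    then obtain f g where "f \<in> carrier M" "g \<in> carrier M" "S = basic_open M f" "T = basic_open M g"
      by auto
    then show "\<exists>h\<in>carrier M. S \<inter> T = basic_open M h"
      by (intro bexI[of _ "f \<otimes>\<^bsub>M\<^esub> g"]) (auto simp: basic_open_mult[OF assms])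
  qed
  then show ?thesis
    by (simp add: filt_top_def topology_inverse')
qed

lemma topspace_filt_top:
  assumes "comm_monoid M"
  shows "topspace (filt_top M) = Filt M"
proof -
  interpret comm_monoid M by fact
  have "basic_open M \<one>\<^bsub>M\<^esub> = Filt M"
    by (auto simp: basic_open_def Filt_def monoid_filter_def)
  then have "openin (filt_top M) (Filt M)"
    unfolding openin_filt_top[OF assms] by (intro arbitrary_union_of_inc bexI[of _ "\<one>\<^bsub>M\<^esub>"]) auto
  moreover have "U \<subseteq> Filt M" if "openin (filt_top M) U" for U
    using that unfolding openin_filt_top[OF assms] union_of_def arbitrary_def basic_open_def
    by auto
  ultimately show ?thesis
    by (intro subset_antisym openin_subset) simp_all
qed


section \<open>Categories and functors\<close>

text \<open>\<open>Comp C X Y Z g f\<close> is the composite of \<open>f : X \<rightarrow> Y\<close> and \<open>g : Y \<rightarrow> Z\<close>.\<close>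

record ('o, 'm) cat =
  Ob :: "'o set"
  Mor :: "'o \<Rightarrow> 'o \<Rightarrow> 'm set"
  Ident :: "'o \<Rightarrow> 'm"
  Comp :: "'o \<Rightarrow> 'o \<Rightarrow> 'o \<Rightarrow> 'm \<Rightarrow> 'm \<Rightarrow> 'm"

locale category =
  fixes C :: "('o, 'm) cat"
  assumes ident_mor: "X \<in> Ob C \<Longrightarrow> Ident C X \<in> Mor C X X"
    and comp_mor: "\<lbrakk>X \<in> Ob C; Y \<in> Ob C; Z \<in> Ob C; f \<in> Mor C X Y; g \<in> Mor C Y Z\<rbrakk>
      \<Longrightarrow> Comp C X Y Z g f \<in> Mor C X Z"
    and comp_ident_right: "\<lbrakk>X \<in> Ob C; Y \<in> Ob C; f \<in> Mor C X Y\<rbrakk>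
      \<Longrightarrow> Comp C X X Y f (Ident C X) = f"
    and comp_ident_left: "\<lbrakk>X \<in> Ob C; Y \<in> Ob C; f \<in> Mor C X Y\<rbrakk>
      \<Longrightarrow> Comp C X Y Y (Ident C Y) f = f"
    and comp_assoc: "\<lbrakk>W \<in> Ob C; X \<in> Ob C; Y \<in> Ob C; Z \<in> Ob C;
        f \<in> Mor C W X; g \<in> Mor C X Y; h \<in> Mor C Y Z\<rbrakk>
      \<Longrightarrow> Comp C W Y Z h (Comp C W X Y g f) = Comp C W X Z (Comp C X Y Z h g) f"

locale covariant_functor = C: category C + D: category D
  for C :: "('o, 'm) cat" and D :: "('p, 'n) cat" +
  fixes Fob :: "'o \<Rightarrow> 'p"
    and Fmor :: "'o \<Rightarrow> 'o \<Rightarrow> 'm \<Rightarrow> 'n"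
  assumes Fob_ob: "X \<in> Ob C \<Longrightarrow> Fob X \<in> Ob D"
    and Fmor_mor: "\<lbrakk>X \<in> Ob C; Y \<in> Ob C; f \<in> Mor C X Y\<rbrakk>
      \<Longrightarrow> Fmor X Y f \<in> Mor D (Fob X) (Fob Y)"
    and Fmor_ident: "X \<in> Ob C \<Longrightarrow> Fmor X X (Ident C X) = Ident D (Fob X)"
    and Fmor_comp: "\<lbrakk>X \<in> Ob C; Y \<in> Ob C; Z \<in> Ob C; f \<in> Mor C X Y; g \<in> Mor C Y Z\<rbrakk>
      \<Longrightarrow> Fmor X Z (Comp C X Y Z g f)
          = Comp D (Fob X) (Fob Y) (Fob Z) (Fmor Y Z g) (Fmor X Y f)"

text \<open>A category in HOL has a single type of objects, so the type \<open>'u\<close> of the underlying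
  elements plays the role of the universe. Morphisms are extensional functions, i.e. they
  carry no information outside of their domain.\<close>

definition comm_monoid_cat :: "('u monoid, 'u \<Rightarrow> 'u) cat" where
  "comm_monoid_cat =
    \<lparr>Ob = {M. comm_monoid M},
     Mor = \<lambda>M N. monoid_hom M N \<inter> extensional (carrier M),
     Ident = \<lambda>M. \<lambda>x\<in>carrier M. x,
     Comp = \<lambda>M N P \<psi> \<phi>. compose (carrier M) \<psi> \<phi>\<rparr>"

definition top_cat :: "('v topology, 'v \<Rightarrow> 'v) cat" where
  "top_cat =
    \<lparr>Ob = UNIV,
     Mor = \<lambda>X Y. {f. continuous_map X Y f} \<inter> extensional (topspace X),
     Ident = \<lambda>X. \<lambda>x\<in>topspace X. x,
     Comp = \<lambda>X Y Z g f. compose (topspace X) g f\<rparr>"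

end

theory Submission
  imports Defs
begin

text \<open>
  The image \<open>\<phi>(F)\<close> of a filter is already closed under products and contains \<open>1\<close>, so the filter
  it generates needs no products: it consists of the divisors of the single elements \<open>\<phi>(f)\<close> with
  \<open>f \<in> F\<close> (\<open>filter_gen_hom_image\<close>). Everything else is read off from this description.

  Continuity: \<open>g \<in> \<phi>\<^sub>*(F)\<close> is witnessed by a single \<open>f \<in> F\<close> with \<open>g\<close> dividing \<open>\<phi>(f)\<close>, and the
  same \<open>f\<close> is a witness for every filter in \<open>D(f)\<close>. Hence the preimage of \<open>D(g)\<close> is the union of
  the sets \<open>D(f)\<close> over all \<open>f\<close> such that \<open>g\<close> divides \<open>\<phi>(f)\<close>.

  Functoriality: a filter contains all divisors of its elements, which is the identity law; and
  homomorphisms preserve divisibility, so that a divisor of \<open>\<psi>(h)\<close>, with \<open>h\<close> a divisor of \<open>\<phi>(f)\<close>,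
  is the same thing as a divisor of \<open>\<psi>(\<phi>(f))\<close>.
\<close>

section \<open>Filters and homomorphisms\<close>

lemma monoid_filterD:
  assumes "monoid_filter M F"
  shows monoid_filter_subset: "F \<subseteq> carrier M"
    and monoid_filter_one: "\<one>\<^bsub>M\<^esub> \<in> F"
    and monoid_filter_mult: "\<lbrakk>f \<in> F; g \<in> F\<rbrakk> \<Longrightarrow> f \<otimes>\<^bsub>M\<^esub> g \<in> F"
    and monoid_filter_divides: "\<lbrakk>f \<in> F; g \<in> carrier M; g divides\<^bsub>M\<^esub> f\<rbrakk> \<Longrightarrow> g \<in> F"
  using assms unfolding monoid_filter_def by blast+

lemma monoid_homD:
  assumes "\<phi> \<in> monoid_hom M N"
  shows monoid_hom_carrier: "x \<in> carrier M \<Longrightarrow> \<phi> x \<in> carrier N"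
    and monoid_hom_mult:
      "\<lbrakk>x \<in> carrier M; y \<in> carrier M\<rbrakk> \<Longrightarrow> \<phi> (x \<otimes>\<^bsub>M\<^esub> y) = \<phi> x \<otimes>\<^bsub>N\<^esub> \<phi> y"
    and monoid_hom_one: "\<phi> \<one>\<^bsub>M\<^esub> = \<one>\<^bsub>N\<^esub>"
  using assms unfolding monoid_hom_def hom_def by auto

lemma monoid_hom_divides:
  assumes "\<phi> \<in> monoid_hom M N" "x \<in> carrier M" "x divides\<^bsub>M\<^esub> y"
  shows "\<phi> x divides\<^bsub>N\<^esub> \<phi> y"
  using assms(2,3) monoid_hom_carrier[OF assms(1)] monoid_hom_mult[OF assms(1)]
  by (auto simp: factor_def)

lemma monoid_hom_ident:
  assumes "monoid M"
  shows "(\<lambda>x\<in>carrier M. x) \<in> monoid_hom M M"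
proof -
  interpret monoid M by fact
  show ?thesis by (auto simp: monoid_hom_def hom_def)
qed

lemma monoid_hom_compose:
  assumes "monoid M" and \<phi>: "\<phi> \<in> monoid_hom M N" and \<psi>: "\<psi> \<in> monoid_hom N P"
  shows "compose (carrier M) \<psi> \<phi> \<in> monoid_hom M P"
proof -
  interpret monoid M by fact
  show ?thesis
    by (auto simp: monoid_hom_def hom_def compose_def monoid_homD[OF \<phi>] monoid_homD[OF \<psi>])
qed

section \<open>The filter generated by the image of a filter\<close>

lemma filter_gen_superset: "S \<subseteq> filter_gen M S"
  unfolding filter_gen_def by (rule hull_subset)

lemma filter_gen_least: "\<lbrakk>S \<subseteq> F; monoid_filter M F\<rbrakk> \<Longrightarrow> filter_gen M S \<subseteq> F"
  unfolding filter_gen_def by (rule hull_minimal)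

text \<open>The divisors of elements of a submonoid form a filter: if \<open>g\<close> divides \<open>s\<close> and \<open>h\<close> divides
  \<open>t\<close>, then \<open>g \<otimes> h\<close> divides \<open>s \<otimes> t\<close>, by commutativity.\<close>

lemma filter_gen_submonoid:
  assumes "comm_monoid M" and sub: "S \<subseteq> carrier M" and one: "\<one>\<^bsub>M\<^esub> \<in> S"
    and mult: "\<And>s t. \<lbrakk>s \<in> S; t \<in> S\<rbrakk> \<Longrightarrow> s \<otimes>\<^bsub>M\<^esub> t \<in> S"
  shows "filter_gen M S = {g \<in> carrier M. \<exists>s\<in>S. g divides\<^bsub>M\<^esub> s}" (is "_ = ?D")
proof
  interpret comm_monoid M by fact
  have "monoid_filter M ?D"
    unfolding monoid_filter_def
  proof (intro conjI ballI impI)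
    show "?D \<subseteq> carrier M" by blast
    show "\<one>\<^bsub>M\<^esub> \<in> ?D"
      using one divides_refl[OF one_closed] by blast
  next
    fix g h assume "g \<in> ?D" "h \<in> ?D"
    then obtain s t where g: "g \<in> carrier M" and h: "h \<in> carrier M" and s: "s \<in> S" and t: "t \<in> S"
      and gs: "g divides\<^bsub>M\<^esub> s" and ht: "h divides\<^bsub>M\<^esub> t"
      by blast
    have sM: "s \<in> carrier M" and tM: "t \<in> carrier M"
      using s t sub by blast+
    have "(g \<otimes>\<^bsub>M\<^esub> h) divides\<^bsub>M\<^esub> (s \<otimes>\<^bsub>M\<^esub> h)"
      using divides_mult_rI[OF gs g sM h] .
    also have "(s \<otimes>\<^bsub>M\<^esub> h) divides\<^bsub>M\<^esub> (s \<otimes>\<^bsub>M\<^esub> t)"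
      using divides_mult_lI[OF ht h sM] .
    finally show "g \<otimes>\<^bsub>M\<^esub> h \<in> ?D"
      using mult[OF s t] g h sM tM by auto
  next
    fix f g assume "f \<in> ?D" "g \<in> carrier M" "g divides\<^bsub>M\<^esub> f"
    then show "g \<in> ?D"
      using divides_trans[of g f] by blast
  qed
  moreover have "S \<subseteq> ?D"
    using sub divides_refl by blast
  ultimately show "filter_gen M S \<subseteq> ?D"
    by (intro filter_gen_least)
  show "?D \<subseteq> filter_gen M S"
    using filter_gen_superset[of S M]
      monoid_filter_divides[OF monoid_filter_filter_gen[OF monoid_axioms sub]]
    by blast
qed

text \<open>For a homomorphism, the image of a filter is a submonoid, though in general not closed under
  divisors; so taking divisors is all that generation adds. One \<open>f\<close> suffices as a witness, which
  is what continuity rests on.\<close>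

lemma filter_gen_hom_image:
  assumes "comm_monoid N" and \<phi>: "\<phi> \<in> monoid_hom M N" and F: "monoid_filter M F"
  shows "filter_gen N (\<phi> ` F) = {g \<in> carrier N. \<exists>f\<in>F. g divides\<^bsub>N\<^esub> \<phi> f}"
proof -
  have inM: "f \<in> carrier M" if "f \<in> F" for f
    using monoid_filter_subset[OF F] that by blast
  have "filter_gen N (\<phi> ` F) = {g \<in> carrier N. \<exists>s\<in>\<phi> ` F. g divides\<^bsub>N\<^esub> s}"
  proof (rule filter_gen_submonoid[OF assms(1)])
    show "\<phi> ` F \<subseteq> carrier N"
      using monoid_hom_carrier[OF \<phi>] inM by blast
    show "\<one>\<^bsub>N\<^esub> \<in> \<phi> ` F"
      using monoid_filter_one[OF F] monoid_hom_one[OF \<phi>] by (metis imageI)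
    show "s \<otimes>\<^bsub>N\<^esub> t \<in> \<phi> ` F" if "s \<in> \<phi> ` F" "t \<in> \<phi> ` F" for s t
    proof -
      obtain a b where ab: "a \<in> F" "b \<in> F" and st: "s = \<phi> a" "t = \<phi> b"
        using \<open>s \<in> \<phi> ` F\<close> \<open>t \<in> \<phi> ` F\<close> by blast
      have "s \<otimes>\<^bsub>N\<^esub> t = \<phi> (a \<otimes>\<^bsub>M\<^esub> b)"
        using monoid_hom_mult[OF \<phi> inM inM] ab st by simp
      then show ?thesis
        using monoid_filter_mult[OF F ab] by simp
    qed
  qed
  then show ?thesis by simp
qed

lemma filt_map_in_Filt:
  assumes "comm_monoid N" "\<phi> \<in> monoid_hom M N" "F \<in> Filt M"
  shows "filt_map M N \<phi> F \<in> Filt N"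
proof -
  interpret N: comm_monoid N by fact
  have "\<phi> ` F \<subseteq> carrier N"
    using assms(3) monoid_hom_carrier[OF assms(2)] by (auto simp: Filt_def dest: monoid_filter_subset)
  then show ?thesis
    using monoid_filter_filter_gen[OF N.monoid_axioms] assms(3) by (simp add: filt_map_def Filt_def)
qed

lemma mem_filt_map_iff:
  assumes "comm_monoid N" "\<phi> \<in> monoid_hom M N" "F \<in> Filt M"
  shows "g \<in> filt_map M N \<phi> F \<longleftrightarrow> g \<in> carrier N \<and> (\<exists>f\<in>F. g divides\<^bsub>N\<^esub> \<phi> f)"
  using filter_gen_hom_image[OF assms(1,2), of F] assms(3) by (simp add: filt_map_def Filt_def)

section \<open>Continuity\<close>

lemma openin_basic_open:
  assumes "comm_monoid M" "f \<in> carrier M"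
  shows "openin (filt_top M) (basic_open M f)"
  using assms(2) unfolding openin_filt_top[OF assms(1)] by (intro arbitrary_union_of_inc) blast

lemma openin_filt_topE:
  assumes "comm_monoid M" "openin (filt_top M) U" "F \<in> U"
  obtains f where "f \<in> carrier M" "F \<in> basic_open M f" "basic_open M f \<subseteq> U"
  using assms(2,3) unfolding openin_filt_top[OF assms(1)] union_of_def arbitrary_def by blast

lemma continuous_map_filt_map:
  assumes M: "comm_monoid M" and N: "comm_monoid N" and \<phi>: "\<phi> \<in> monoid_hom M N"
  shows "continuous_map (filt_top M) (filt_top N) (filt_map M N \<phi>)"
  unfolding continuous_map_def topspace_filt_top[OF M] topspace_filt_top[OF N]
proof (intro conjI allI impI)
  show "filt_map M N \<phi> \<in> Filt M \<rightarrow> Filt N"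
    using filt_map_in_Filt[OF N \<phi>] by blast
next
  fix U assume U: "openin (filt_top N) U"
  let ?V = "{F \<in> Filt M. filt_map M N \<phi> F \<in> U}"
  have "\<exists>T. openin (filt_top M) T \<and> F \<in> T \<and> T \<subseteq> ?V" if "F \<in> ?V" for F
  proof -
    have F: "F \<in> Filt M" and FU: "filt_map M N \<phi> F \<in> U"
      using that by blast+
    obtain g where g: "g \<in> carrier N" "filt_map M N \<phi> F \<in> basic_open N g"
      and gU: "basic_open N g \<subseteq> U"
      using openin_filt_topE[OF N U FU] .
    obtain f where f: "f \<in> F" "g divides\<^bsub>N\<^esub> \<phi> f"
      using g(2) mem_filt_map_iff[OF N \<phi> F] unfolding basic_open_def by blast
    \<comment> \<open>The witness \<open>f\<close> does not depend on the filter, so it serves all filters containing it.\<close>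
    have "filt_map M N \<phi> G \<in> basic_open N g" if "G \<in> basic_open M f" for G
      using that f(2) g(1) filt_map_in_Filt[OF N \<phi>] mem_filt_map_iff[OF N \<phi>]
      by (auto simp: basic_open_def)
    then have "basic_open M f \<subseteq> ?V"
      using gU by (auto simp: basic_open_def)
    moreover have "f \<in> carrier M"
      using f(1) F by (auto simp: Filt_def dest: monoid_filter_subset)
    moreover have "F \<in> basic_open M f"
      using f(1) F by (simp add: basic_open_def)
    ultimately show ?thesis
      using openin_basic_open[OF M] by blast
  qed
  then show "openin (filt_top M) ?V"
    by (subst openin_subopen) blast
qed

section \<open>Functoriality\<close>

lemma filt_map_ident:
  assumes "comm_monoid M"
  shows "filt_map M M (\<lambda>x\<in>carrier M. x) = (\<lambda>F\<in>Filt M. F)"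
proof (rule extensionalityI[where A = "Filt M"])
  interpret comm_monoid M by fact
  fix F assume F: "F \<in> Filt M"
  then have filter: "monoid_filter M F" by (simp add: Filt_def)
  then have sub: "F \<subseteq> carrier M" by (rule monoid_filter_subset)
  then have "(\<lambda>x\<in>carrier M. x) ` F = F" by force
  moreover have "filter_gen M F = F"
    using filter_gen_superset[of F M] filter_gen_least[OF subset_refl filter] by blast
  ultimately show "filt_map M M (\<lambda>x\<in>carrier M. x) F = (\<lambda>F\<in>Filt M. F) F"
    using F by (simp add: filt_map_def)
qed (simp_all add: filt_map_def)

lemma filt_map_compose:
  assumes M: "comm_monoid M" and N: "comm_monoid N" and P: "comm_monoid P"
    and \<phi>: "\<phi> \<in> monoid_hom M N" and \<psi>: "\<psi> \<in> monoid_hom N P"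
  shows "filt_map M P (compose (carrier M) \<psi> \<phi>) =
    compose (Filt M) (filt_map N P \<psi>) (filt_map M N \<phi>)"
proof (rule extensionalityI[where A = "Filt M"])
  interpret M: comm_monoid M by fact
  interpret N: comm_monoid N by fact
  interpret P: comm_monoid P by fact
  let ?\<psi>\<phi> = "compose (carrier M) \<psi> \<phi>"
  fix F assume F: "F \<in> Filt M"
  then have sub: "F \<subseteq> carrier M" by (auto simp: Filt_def dest: monoid_filter_subset)
  note comp = monoid_hom_compose[OF M.monoid_axioms \<phi> \<psi>]
  have "p \<in> filt_map M P ?\<psi>\<phi> F \<longleftrightarrow> p \<in> filt_map N P \<psi> (filt_map M N \<phi> F)" for p
  proof -
    have "(\<exists>f\<in>F. p divides\<^bsub>P\<^esub> \<psi> (\<phi> f)) \<longleftrightarrow>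
        (\<exists>h\<in>carrier N. (\<exists>f\<in>F. h divides\<^bsub>N\<^esub> \<phi> f) \<and> p divides\<^bsub>P\<^esub> \<psi> h)"
      if p: "p \<in> carrier P"
    proof
      \<comment> \<open>Here \<open>h = \<phi> f\<close>; the converse is transitivity through \<open>\<psi> h\<close>.\<close>
      assume "\<exists>f\<in>F. p divides\<^bsub>P\<^esub> \<psi> (\<phi> f)"
      then show "\<exists>h\<in>carrier N. (\<exists>f\<in>F. h divides\<^bsub>N\<^esub> \<phi> f) \<and> p divides\<^bsub>P\<^esub> \<psi> h"
        using sub monoid_hom_carrier[OF \<phi>] N.divides_refl by blast
    next
      assume "\<exists>h\<in>carrier N. (\<exists>f\<in>F. h divides\<^bsub>N\<^esub> \<phi> f) \<and> p divides\<^bsub>P\<^esub> \<psi> h"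
      then show "\<exists>f\<in>F. p divides\<^bsub>P\<^esub> \<psi> (\<phi> f)"
        using monoid_hom_divides[OF \<psi>] P.divides_trans[OF _ _ p] by blast
    qed
    moreover have "(\<exists>f\<in>F. p divides\<^bsub>P\<^esub> ?\<psi>\<phi> f) \<longleftrightarrow> (\<exists>f\<in>F. p divides\<^bsub>P\<^esub> \<psi> (\<phi> f))"
      using sub by (intro bex_cong) (auto simp: compose_def)
    ultimately show ?thesis
      unfolding mem_filt_map_iff[OF P comp F] mem_filt_map_iff[OF P \<psi> filt_map_in_Filt[OF N \<phi> F]]
        Bex_def mem_filt_map_iff[OF N \<phi> F] by blast
  qed
  then show "filt_map M P ?\<psi>\<phi> F = compose (Filt M) (filt_map N P \<psi>) (filt_map M N \<phi>) F"
    using F by (auto simp: compose_def)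
qed (simp_all add: filt_map_def)

lemma category_comm_monoid_cat: "category comm_monoid_cat"
proof
  fix W X Y Z :: "'u monoid" and f g h :: "'u \<Rightarrow> 'u"
  show "Ident comm_monoid_cat X \<in> Mor comm_monoid_cat X X" if "X \<in> Ob comm_monoid_cat"
    using that monoid_hom_ident[of X] by (simp add: comm_monoid_cat_def comm_monoid.axioms(1))
  show "Comp comm_monoid_cat X Y Z g f \<in> Mor comm_monoid_cat X Z"
    if "X \<in> Ob comm_monoid_cat" "f \<in> Mor comm_monoid_cat X Y" "g \<in> Mor comm_monoid_cat Y Z"
    using that monoid_hom_compose[of X f Y g Z]
    by (simp add: comm_monoid_cat_def comm_monoid.axioms(1))
  show "Comp comm_monoid_cat X X Y f (Ident comm_monoid_cat X) = f"
    if "f \<in> Mor comm_monoid_cat X Y"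
    using that by (auto simp: comm_monoid_cat_def compose_def fun_eq_iff extensional_def)
  show "Comp comm_monoid_cat X Y Y (Ident comm_monoid_cat Y) f = f"
    if "f \<in> Mor comm_monoid_cat X Y"
    using that monoid_hom_carrier[of f X Y]
    by (auto simp: comm_monoid_cat_def compose_def fun_eq_iff extensional_def)
  show "Comp comm_monoid_cat W Y Z h (Comp comm_monoid_cat W X Y g f)
      = Comp comm_monoid_cat W X Z (Comp comm_monoid_cat X Y Z h g) f"
    if "f \<in> Mor comm_monoid_cat W X"
    using that monoid_hom_carrier[of f W X]
    by (auto simp: comm_monoid_cat_def compose_def fun_eq_iff)
qed

lemma category_top_cat: "category top_cat"
proof
  fix W X Y Z :: "'v topology" and f g h :: "'v \<Rightarrow> 'v"
  have topspace_mor: "f x \<in> topspace Y" if "continuous_map X Y f" "x \<in> topspace X" for f x X Y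
    using that by (auto simp: continuous_map_def)
  show "Ident top_cat X \<in> Mor top_cat X X"
    using continuous_map_eq[OF continuous_map_id[of X], of "\<lambda>x\<in>topspace X. x"]
    by (simp add: top_cat_def)
  show "Comp top_cat X Y Z g f \<in> Mor top_cat X Z"
    if "f \<in> Mor top_cat X Y" "g \<in> Mor top_cat Y Z"
    using that continuous_map_eq[OF continuous_map_compose[of X Y f Z g], of "compose (topspace X) g f"]
    by (simp add: top_cat_def compose_def)
  show "Comp top_cat X X Y f (Ident top_cat X) = f" if "f \<in> Mor top_cat X Y"
    using that by (auto simp: top_cat_def compose_def fun_eq_iff extensional_def)
  show "Comp top_cat X Y Y (Ident top_cat Y) f = f" if "f \<in> Mor top_cat X Y"
    using that topspace_mor[of X Y f] by (auto simp: top_cat_def compose_def fun_eq_iff extensional_def)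
  show "Comp top_cat W Y Z h (Comp top_cat W X Y g f)
      = Comp top_cat W X Z (Comp top_cat X Y Z h g) f"
    if "f \<in> Mor top_cat W X"
    using that topspace_mor[of W X f] by (auto simp: top_cat_def compose_def fun_eq_iff)
qed

lemma covariant_functor_filt: "covariant_functor comm_monoid_cat top_cat filt_top filt_map"
proof (intro covariant_functor.intro covariant_functor_axioms.intro
    category_comm_monoid_cat category_top_cat)
  fix X Y Z :: "'u monoid" and f g :: "'u \<Rightarrow> 'u"
  show "filt_top X \<in> Ob top_cat"
    by (simp add: top_cat_def)
  show "filt_map X Y f \<in> Mor top_cat (filt_top X) (filt_top Y)"
    if "X \<in> Ob comm_monoid_cat" "Y \<in> Ob comm_monoid_cat" "f \<in> Mor comm_monoid_cat X Y"
    using that continuous_map_filt_map[of X Y f]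
    by (simp add: comm_monoid_cat_def top_cat_def topspace_filt_top filt_map_def)
  show "filt_map X X (Ident comm_monoid_cat X) = Ident top_cat (filt_top X)"
    if "X \<in> Ob comm_monoid_cat"
    using that filt_map_ident[of X] by (simp add: comm_monoid_cat_def top_cat_def topspace_filt_top)
  show "filt_map X Z (Comp comm_monoid_cat X Y Z g f) =
      Comp top_cat (filt_top X) (filt_top Y) (filt_top Z) (filt_map Y Z g) (filt_map X Y f)"
    if "X \<in> Ob comm_monoid_cat" "Y \<in> Ob comm_monoid_cat" "Z \<in> Ob comm_monoid_cat"
      "f \<in> Mor comm_monoid_cat X Y" "g \<in> Mor comm_monoid_cat Y Z"
    using that filt_map_compose[of X Y Z f g]
    by (simp add: comm_monoid_cat_def top_cat_def topspace_filt_top)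
qed

text \<open>The last conjunct is functoriality on the commutative monoids over one arbitrary type
  \<open>'u\<close>; the conjuncts before it give the same laws for monoids over different types.\<close>

theorem mainTheorem2:
  fixes M :: "('a, 'm) monoid_scheme"
    and N :: "('b, 'n) monoid_scheme"
    and \<phi> :: "'a \<Rightarrow> 'b"
  assumes "comm_monoid M"
    and "comm_monoid N"
    and "\<phi> \<in> monoid_hom M N"
  shows "continuous_map (filt_top M) (filt_top N) (filt_map M N \<phi>) \<and>
    filt_map M M (\<lambda>x\<in>carrier M. x) = (\<lambda>F\<in>Filt M. F) \<and>
    (\<forall>(P :: ('c, 'p) monoid_scheme) \<psi>. comm_monoid P \<and> \<psi> \<in> monoid_hom N P \<longrightarrow>
       filt_map M P (compose (carrier M) \<psi> \<phi>) =
       compose (Filt M) (filt_map N P \<psi>) (filt_map M N \<phi>)) \<and>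
    covariant_functor (comm_monoid_cat :: ('u monoid, 'u \<Rightarrow> 'u) cat) top_cat filt_top filt_map"
  using continuous_map_filt_map[OF assms] filt_map_ident[OF assms(1)]
    filt_map_compose[OF assms(1,2) _ assms(3)] covariant_functor_filt
  by blast

end
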